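(* Let $(\Omega,\mathcal{F},\mathbb{P})$ be a probability space, let $Y\in\mathcal{L}^2$ be a real-valued random variable on it, and let $X_1,\dots,X_N$ be calibrated predictions of $Y$ with information sets $\mathcal{F}_1,\dots,\mathcal{F}_N$, i.e. $\mathcal{F}_j=\sigma(X_j)$ and $X_j=\mathbb{E}(Y\mid\mathcal{F}_j)$ a.s. Let $\mathcal{X}'':=\mathbb{E}(Y\mid X_1,\dots,X_N)$ and let $\mathcal{X}_{(\cdot)}$ be a strict mean of $X_1,\dots,X_N$. Suppose $|\mathcal{F}_j|<\infty$ for all $j=1,\dots,N$. If at least two predictions disagree with positive probability, i.e. $\mathbb{P}(X_i\neq X_j)>0$ for some pair $i\neq j$, then $\mathcal{X}_{(\cdot)}$ is inefficient, that is, $\mathbb{P}(\mathcal{X}_{(\cdot)}\neq\mathcal{X}'')>0$.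
   Context: All random variables are defined on the common probability space $(\Omega,\mathcal{F},\mathbb{P})$, and $\mathcal{L}^2$ denotes the random variables with finite second moment. An aggregator of $X_1,\dots,X_N$ is any random variable measurable with respect to $\sigma(X_1,\dots,X_N)$. A strict mean $\mathcal{X}_{(\cdot)}$ is an aggregator that equals the unanimous prediction whenever all predictions agree, and that, whenever at least two of the predictions disagree, remains strictly between the smallest and the largest prediction: $\mathcal{X}_{(\cdot)}\in\left(\min(X_1,\dots,X_N),\max(X_1,\dots,X_N)\right)$. An aggregator is efficient if it equals $\mathcal{X}''$ a.s. The cardinality $|\mathcal{F}_j|$ is the number of events in the $\sigma$-field $\mathcal{F}_j$. *)

theory Defs
  imports "HOL-Probability.Probability"
begin

text \<open>
  Sub-sigma-fields are represented as in \<^theory>\<open>HOL-Probability.Conditional_Expectation\<close>, namely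
  as measures of which only the space and the measurable sets matter.
\<close>

definition info_set :: "'a measure \<Rightarrow> ('a \<Rightarrow> real) \<Rightarrow> 'a measure" where
  "info_set M X = vimage_algebra (space M) X borel"

definition joint_info :: "'a measure \<Rightarrow> nat \<Rightarrow> (nat \<Rightarrow> 'a \<Rightarrow> real) \<Rightarrow> 'a measure" where
  "joint_info M N X = sigma (space M) (\<Union>j\<in>{1..N}. sets (info_set M (X j)))"

definition calibrated :: "'a measure \<Rightarrow> ('a \<Rightarrow> real) \<Rightarrow> ('a \<Rightarrow> real) \<Rightarrow> bool" where
  "calibrated M Y X \<longleftrightarrow>
     X \<in> borel_measurable M \<and> (AE \<omega> in M. X \<omega> = real_cond_exp M (info_set M X) Y \<omega>)"

definition aggregator :: "'a measure \<Rightarrow> nat \<Rightarrow> (nat \<Rightarrow> 'a \<Rightarrow> real) \<Rightarrow> ('a \<Rightarrow> real) \<Rightarrow> bool" where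
  "aggregator M N X A \<longleftrightarrow> A \<in> borel_measurable (joint_info M N X)"

text \<open>The two conditions are required at every outcome, not merely almost surely.\<close>

definition strict_mean :: "'a measure \<Rightarrow> nat \<Rightarrow> (nat \<Rightarrow> 'a \<Rightarrow> real) \<Rightarrow> ('a \<Rightarrow> real) \<Rightarrow> bool" where
  "strict_mean M N X A \<longleftrightarrow>
     aggregator M N X A \<and>
     (\<forall>\<omega>\<in>space M.
        ((\<forall>i\<in>{1..N}. \<forall>j\<in>{1..N}. X i \<omega> = X j \<omega>) \<longrightarrow> (\<forall>j\<in>{1..N}. A \<omega> = X j \<omega>)) \<and>
        ((\<exists>i\<in>{1..N}. \<exists>j\<in>{1..N}. X i \<omega> \<noteq> X j \<omega>) \<longrightarrow>
           A \<omega> \<in> {Min ((\<lambda>j. X j \<omega>) ` {1..N}) <..< Max ((\<lambda>j. X j \<omega>) ` {1..N})}))"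

definition revealed_aggregator ::
    "'a measure \<Rightarrow> nat \<Rightarrow> ('a \<Rightarrow> real) \<Rightarrow> (nat \<Rightarrow> 'a \<Rightarrow> real) \<Rightarrow> 'a \<Rightarrow> real" where
  "revealed_aggregator M N Y X = real_cond_exp M (joint_info M N X) Y"

definition efficient ::
    "'a measure \<Rightarrow> nat \<Rightarrow> ('a \<Rightarrow> real) \<Rightarrow> (nat \<Rightarrow> 'a \<Rightarrow> real) \<Rightarrow> ('a \<Rightarrow> real) \<Rightarrow> bool" where
  "efficient M N Y X A \<longleftrightarrow> (AE \<omega> in M. A \<omega> = revealed_aggregator M N Y X \<omega>)"

end

theory Submission
  imports Defs
begin

text \<open>
  Suppose the strict mean \<open>A\<close> equals \<open>\<X>'' = E(Y | X\<^sub>1, \<dots>, X\<^sub>N)\<close> almost surely, and let \<open>c\<close> be the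
  largest value that the maximal prediction attains with positive probability while some predictions
  disagree; it exists because the predictions take finitely many values. Some \<open>X\<^sub>j\<close> equals \<open>c\<close>
  with positive probability on the disagreement event. On \<open>{X\<^sub>j = c}\<close> we have \<open>A \<le> c\<close> almost surely,
  with strict inequality under disagreement. But \<open>A\<close> and \<open>X\<^sub>j\<close> both integrate to \<open>E(Y; X\<^sub>j = c)\<close>
  over that event, a contradiction.
\<close>

text \<open>Fibres of distinct values are disjoint and nonempty, hence distinct events of the
  sigma-field, so there are at most as many values as events.\<close>

lemma finite_image_if_finite_info_set:
  assumes "finite (sets (info_set M X))"
  shows "finite (X ` space M)"
proof -
  have "inj_on (\<lambda>c. X -` {c} \<inter> space M) (X ` space M)"
    by (auto simp: inj_on_def)
  moreover have "(\<lambda>c. X -` {c} \<inter> space M) ` (X ` space M) \<subseteq> sets (info_set M X)"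
    unfolding info_set_def by (intro image_subsetI in_vimage_algebra) simp
  ultimately show ?thesis
    using assms by (rule inj_on_finite)
qed

lemma subalgebra_info_set:
  assumes "X \<in> borel_measurable M"
  shows "subalgebra M (info_set M X)"
  using assms by (auto simp: subalgebra_def info_set_def sets_vimage_algebra2 measurable_sets)

lemma sets_joint_info:
  "sets (joint_info M N X) = sigma_sets (space M) (\<Union>j\<in>{1..N}. sets (info_set M (X j)))"
proof -
  have "sets (info_set M (X j)) \<subseteq> Pow (space M)" for j
    using sets.space_closed[of "info_set M (X j)"] by (simp add: info_set_def)
  then show ?thesis
    unfolding joint_info_def by (intro sets_measure_of) blast
qed

lemma subalgebra_joint_info:
  assumes "\<And>j. j \<in> {1..N} \<Longrightarrow> X j \<in> borel_measurable M"
  shows "subalgebra M (joint_info M N X)"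
proof -
  have "(\<Union>j\<in>{1..N}. sets (info_set M (X j))) \<subseteq> sets M"
    using assms subalgebra_info_set unfolding subalgebra_def by blast
  then have "sets (joint_info M N X) \<subseteq> sets M"
    unfolding sets_joint_info by (rule sets.sigma_sets_subset)
  then show ?thesis
    by (simp add: subalgebra_def joint_info_def space_measure_of_conv)
qed

text \<open>The event \<open>X j = c\<close> belongs both to the field of \<open>X j\<close> and to
  the joint one, so over it \<open>X j\<close> and the revealed aggregator have the same integral,
  that of \<open>Y\<close>. A difference of one sign with integral zero vanishes almost
  everywhere.\<close>

lemma (in finite_measure) calibrated_AE_eq_if_le:
  assumes Y: "integrable M Y"
    and X: "\<And>j. j \<in> {1..N} \<Longrightarrow> X j \<in> borel_measurable M"
    and cal: "calibrated M Y (X j)" and j: "j \<in> {1..N}"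
    and le: "AE \<omega> in M. X j \<omega> = c \<longrightarrow> revealed_aggregator M N Y X \<omega> \<le> c"
  shows "AE \<omega> in M. X j \<omega> = c \<longrightarrow> revealed_aggregator M N Y X \<omega> = c"
proof -
  define B where "B = X j -` {c} \<inter> space M"
  let ?Z = "revealed_aggregator M N Y X"
  interpret J: finite_measure_subalgebra M "joint_info M N X"
    by unfold_locales (intro subalgebra_joint_info X)
  interpret I: finite_measure_subalgebra M "info_set M (X j)"
    by unfold_locales (intro subalgebra_info_set X j)
  have BI: "B \<in> sets (info_set M (X j))"
    unfolding B_def info_set_def by (rule in_vimage_algebra) simp
  then have BJ: "B \<in> sets (joint_info M N X)"
    unfolding sets_joint_info using j by blast
  have BM: "B \<in> sets M"
    using X[OF j] unfolding B_def by simp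
  have Xae: "AE \<omega> in M. X j \<omega> = real_cond_exp M (info_set M (X j)) Y \<omega>"
    using cal unfolding calibrated_def by simp
  \<comment> \<open>\<open>calibrated\<close> only asks for measurability; integrability is
    inherited from the conditional expectation of \<open>Y\<close>.\<close>
  have iX: "integrable M (X j)"
    by (rule integrable_cong_AE_imp[OF I.real_cond_exp_int(1)[OF Y] X[OF j]])
      (use Xae in auto)
  have iZ: "integrable M ?Z"
    unfolding revealed_aggregator_def by (rule J.real_cond_exp_int(1)[OF Y])
  have intX: "(\<integral>\<omega>\<in>B. X j \<omega> \<partial>M) = (\<integral>\<omega>\<in>B. Y \<omega> \<partial>M)"
  proof -
    have "(\<integral>\<omega>\<in>B. X j \<omega> \<partial>M) = (\<integral>\<omega>\<in>B. real_cond_exp M (info_set M (X j)) Y \<omega> \<partial>M)"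
      by (rule set_lebesgue_integral_cong_AE[OF BM X[OF j]]) (use Xae in auto)
    also have "\<dots> = (\<integral>\<omega>\<in>B. Y \<omega> \<partial>M)"
      by (rule I.real_cond_exp_intA[OF Y BI, symmetric])
    finally show ?thesis .
  qed
  have intZ: "(\<integral>\<omega>\<in>B. ?Z \<omega> \<partial>M) = (\<integral>\<omega>\<in>B. Y \<omega> \<partial>M)"
    unfolding revealed_aggregator_def by (rule J.real_cond_exp_intA[OF Y BJ, symmetric])
  \<comment> \<open>This is \<open>c - ?Z\<close> on \<open>B\<close> and zero elsewhere.\<close>
  define g where "g = (\<lambda>\<omega>. indicator B \<omega> * X j \<omega> - indicator B \<omega> * ?Z \<omega>)"
  have ig: "integrable M (\<lambda>\<omega>. indicator B \<omega> * X j \<omega>)" "integrable M (\<lambda>\<omega>. indicator B \<omega> * ?Z \<omega>)"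
    using integrable_mult_indicator[OF BM iX] integrable_mult_indicator[OF BM iZ] by simp_all
  have "integral\<^sup>L M g = 0"
    using intX intZ ig unfolding g_def set_lebesgue_integral_def by simp
  moreover have "integrable M g"
    unfolding g_def using ig by simp
  moreover have "AE \<omega> in M. 0 \<le> g \<omega>"
    using le by eventually_elim (auto simp: g_def B_def indicator_def)
  ultimately have "AE \<omega> in M. g \<omega> = 0"
    using integral_nonneg_eq_0_iff_AE by blast
  then show ?thesis
    using AE_space by eventually_elim (auto simp: g_def B_def indicator_def)
qed

theorem theorem3p7:
  fixes M :: "'a measure" and N :: nat
    and Y :: "'a \<Rightarrow> real" and X :: "nat \<Rightarrow> 'a \<Rightarrow> real" and A :: "'a \<Rightarrow> real"
  assumes "prob_space M"
    and "Y \<in> borel_measurable M" and "integrable M (\<lambda>\<omega>. (Y \<omega>)\<^sup>2)"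
    and "\<And>j. j \<in> {1..N} \<Longrightarrow> calibrated M Y (X j)"
    and "strict_mean M N X A"
    and "\<And>j. j \<in> {1..N} \<Longrightarrow> finite (sets (info_set M (X j)))"
    and "\<exists>i\<in>{1..N}. \<exists>j\<in>{1..N}. i \<noteq> j \<and> \<P>(\<omega> in M. X i \<omega> \<noteq> X j \<omega>) > 0"
  shows "\<not> efficient M N Y X A \<and>
    \<P>(\<omega> in M. A \<omega> \<noteq> revealed_aggregator M N Y X \<omega>) > 0"
proof -
  interpret prob_space M by fact
  let ?Z = "revealed_aggregator M N Y X"
  define D where "D \<omega> \<longleftrightarrow> (\<exists>i\<in>{1..N}. \<exists>j\<in>{1..N}. X i \<omega> \<noteq> X j \<omega>)" for \<omega>
  define f where "f \<omega> = Max ((\<lambda>j. X j \<omega>) ` {1..N})" for \<omega>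
  have X: "X j \<in> borel_measurable M" if "j \<in> {1..N}" for j
    using assms(4)[OF that] by (simp add: calibrated_def)
  have subalg: "subalgebra M (joint_info M N X)"
    by (rule subalgebra_joint_info) (rule X)
  have N: "{1..N} \<noteq> {}"
    using assms(7) by auto
  have Y: "integrable M Y"
    using assms(2,3) square_integrable_imp_integrable by blast
  have mean_eq: "A \<omega> = X j \<omega>" if "\<omega> \<in> space M" "\<not> D \<omega>" "j \<in> {1..N}" for \<omega> j
    using assms(5) that unfolding strict_mean_def D_def by blast
  have mean_less: "A \<omega> < f \<omega>" if "\<omega> \<in> space M" "D \<omega>" for \<omega>
    using assms(5) that unfolding strict_mean_def D_def f_def greaterThanLessThan_iff by blast
  have f_in: "\<exists>j\<in>{1..N}. f \<omega> = X j \<omega>" for \<omega>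
  proof -
    have "f \<omega> \<in> (\<lambda>j. X j \<omega>) ` {1..N}"
      unfolding f_def by (rule Max_in) (use N in blast)+
    then show ?thesis
      by blast
  qed
  have not_eff: "\<not> efficient M N Y X A"
  proof
    assume "efficient M N Y X A"
    then have eff: "AE \<omega> in M. A \<omega> = ?Z \<omega>"
      by (simp add: efficient_def)
    \<comment> \<open>An almost sure upper bound of \<open>f\<close> under disagreement is almost
      surely not attained there; this will be applied to the largest value that is attained.\<close>
    have step: "AE \<omega> in M. \<not> (D \<omega> \<and> f \<omega> = c)" if le: "AE \<omega> in M. D \<omega> \<longrightarrow> f \<omega> \<le> c" for c
    proof -
      have "AE \<omega> in M. X j \<omega> = c \<longrightarrow> \<not> D \<omega>" if j: "j \<in> {1..N}" for j
      proof -
        \<comment> \<open>Without disagreement \<open>A\<close> equals \<open>X j = c\<close>; with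
          it, \<open>A < f \<le> c\<close>. Efficiency carries the bound over to
          \<open>?Z\<close>.\<close>
        have "AE \<omega> in M. X j \<omega> = c \<longrightarrow> ?Z \<omega> \<le> c"
          using eff le AE_space
        proof eventually_elim
          case (elim \<omega>)
          then show ?case
            using mean_eq[of \<omega> j] mean_less[of \<omega>] j by (cases "D \<omega>") auto
        qed
        then have "AE \<omega> in M. X j \<omega> = c \<longrightarrow> ?Z \<omega> = c"
          by (intro calibrated_AE_eq_if_le Y X assms(4) j)
        \<comment> \<open>Under disagreement \<open>A < f \<le> c\<close> would contradict
          \<open>A = ?Z = c\<close>.\<close>
        with eff le AE_space show ?thesis
        proof eventually_elim
          case (elim \<omega>)
          then show ?case
            using mean_less[of \<omega>] by auto
        qed
      qed
      then have "AE \<omega> in M. \<forall>j\<in>{1..N}. X j \<omega> = c \<longrightarrow> \<not> D \<omega>"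
        by (intro AE_finite_allI) auto
      then show ?thesis
        by eventually_elim (metis f_in)
    qed
    define S where "S = (\<Union>j\<in>{1..N}. X j ` space M)"
    have "finite S"
      unfolding S_def by (intro finite_UN_I finite_image_if_finite_info_set assms(6)) auto
    have fS: "f \<omega> \<in> S" if "\<omega> \<in> space M" for \<omega>
      using f_in[of \<omega>] that unfolding S_def by auto
    \<comment> \<open>The values of \<open>f\<close> that are not negligible under disagreement.
      Phrasing this by \<open>AE\<close> instead of a positive probability avoids measurability
      questions about \<open>D\<close> and \<open>f\<close>.\<close>
    define C where "C = {c\<in>S. \<not> (AE \<omega> in M. \<not> (D \<omega> \<and> f \<omega> = c))}"
    have "finite C"
      using \<open>finite S\<close> unfolding C_def by simp
    have AE_S: "AE \<omega> in M. \<forall>c\<in>S - C. \<not> (D \<omega> \<and> f \<omega> = c)"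
      by (intro AE_finite_allI) (use \<open>finite S\<close> in \<open>auto simp: C_def\<close>)
    have "C = {}"
    proof (rule ccontr)
      assume "C \<noteq> {}"
      \<comment> \<open>Under disagreement \<open>f\<close> lies in \<open>S\<close> and almost
        surely avoids \<open>S - C\<close>, so it lies in \<open>C\<close>.\<close>
      have "AE \<omega> in M. D \<omega> \<longrightarrow> f \<omega> \<le> Max C"
        using AE_S AE_space
      proof eventually_elim
        case (elim \<omega>)
        then show ?case
          using fS[of \<omega>] Max_ge[OF \<open>finite C\<close>] by blast
      qed
      from step[OF this] show False
        using Max_in[OF \<open>finite C\<close> \<open>C \<noteq> {}\<close>] unfolding C_def by blast
    qed
    have nD: "AE \<omega> in M. \<not> D \<omega>"
      \<comment> \<open>With \<open>C\<close> empty, every possible value of \<open>f\<close> is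
        excluded under disagreement.\<close>
      using AE_S AE_space by eventually_elim (use fS \<open>C = {}\<close> in blast)
    obtain i j where ij: "i \<in> {1..N}" "j \<in> {1..N}" "\<P>(\<omega> in M. X i \<omega> \<noteq> X j \<omega>) > 0"
      using assms(7) by blast
    have "AE \<omega> in M. \<not> X i \<omega> \<noteq> X j \<omega>"
      using nD by eventually_elim (use ij(1,2) D_def in blast)
    then have "\<P>(\<omega> in M. X i \<omega> \<noteq> X j \<omega>) = 0"
      using borel_measurable_neq[OF X[OF ij(1)] X[OF ij(2)]] by (subst prob_Collect_eq_0)
    with ij show False
      by simp
  qed
  \<comment> \<open>The failure of an \<open>AE\<close> statement yields positive probability only
    once the exceptional event is known to be measurable.\<close>
  have "A \<in> borel_measurable (joint_info M N X)"
    using assms(5) unfolding strict_mean_def aggregator_def by blast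
  then have "A \<in> borel_measurable M"
    by (rule measurable_from_subalg[OF subalg])
  moreover have "?Z \<in> borel_measurable M"
    unfolding revealed_aggregator_def by (rule borel_measurable_cond_exp2)
  ultimately have "{\<omega>\<in>space M. A \<omega> \<noteq> ?Z \<omega>} \<in> sets M"
    by (rule borel_measurable_neq)
  then have "\<P>(\<omega> in M. A \<omega> \<noteq> ?Z \<omega>) \<noteq> 0"
    using not_eff unfolding efficient_def by (subst prob_Collect_eq_0) auto
  then show ?thesis
    using not_eff by (simp add: zero_less_measure_iff)
qed

end
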